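(* Let $A,B,\hat\Omega\in\mathbb{R}^{n\times n}$ and $c\in\mathbb{R}^n$, let $A=\hat M-\hat N$ with $\hat M,\hat N\in\mathbb{R}^{n\times n}$, and let $\theta\ge 0$. If $\theta\hat M+\hat\Omega$ is nonsingular and $$\|(\theta\hat M+\hat\Omega)^{-1}(\hat\Omega+(\theta-1)\hat M+\hat N)\|+\|(\theta\hat M+\hat\Omega)^{-1}B\|<1,$$ then the system $Ax-B|x|-c=0$ has a unique solution $x^*\in\mathbb{R}^n$, and for every initial vector $x^0\in\mathbb{R}^n$ the relaxed Newton-based matrix splitting iteration $$x^{k+1}=(\theta\hat M+\hat\Omega)^{-1}\left[(\hat\Omega+(\theta-1)\hat M+\hat N)x^k+B|x^k|+c\right],\qquad k=0,1,2,\dots,$$ converges linearly to $x^*$.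
   Context: For $x\in\mathbb{R}^n$, $|x|=(|x_1|,\dots,|x_n|)^\top$ is the componentwise absolute value. $\|\cdot\|$ denotes the Euclidean norm of vectors and the induced $2$-norm (spectral norm) of matrices. A sequence $\{x^k\}$ converges linearly to $x^*$ if there is a constant $q\in[0,1)$ such that $\|x^{k+1}-x^*\|\le q\,\|x^k-x^*\|$ for all $k\ge 0$. *)

theory Defs
  imports "HOL-Analysis.Analysis"
begin

text \<open>
  On \<^typ>\<open>real ^ 'n\<close> the library's \<^term>\<open>\<bar>x\<bar>\<close> is the componentwise absolute value
  (fact \<open>abs_vec_def\<close>), and \<^term>\<open>norm x\<close> is the Euclidean norm.  The library's
  \<^term>\<open>norm M\<close> of a matrix is \<^emph>\<open>not\<close> the spectral norm (it is the Frobenius norm), hence the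
  following definition through the operator norm of the induced map.
\<close>

definition spectral_norm :: "real ^ 'n ^ 'm \<Rightarrow> real"
  where "spectral_norm M = onorm ((*v) M)"

definition converges_linearly :: "(nat \<Rightarrow> 'a::real_normed_vector) \<Rightarrow> 'a \<Rightarrow> bool"
  where "converges_linearly x l \<longleftrightarrow>
    (\<exists>q. 0 \<le> q \<and> q < 1 \<and> (\<forall>k. norm (x (Suc k) - l) \<le> q * norm (x k - l)))"

text \<open>Relaxed Newton-based matrix splitting iteration started at \<open>x0\<close>.\<close>

primrec rnms_iter ::
  "real \<Rightarrow> real ^ 'n ^ 'n \<Rightarrow> real ^ 'n ^ 'n \<Rightarrow> real ^ 'n ^ 'n \<Rightarrow> real ^ 'n ^ 'n \<Rightarrow> real ^ 'n
    \<Rightarrow> real ^ 'n \<Rightarrow> nat \<Rightarrow> real ^ 'n"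
  where
    "rnms_iter \<theta> M N \<Omega> B c x0 0 = x0"
  | "rnms_iter \<theta> M N \<Omega> B c x0 (Suc k) =
      matrix_inv (\<theta> *\<^sub>R M + \<Omega>) *v
        ((\<Omega> + (\<theta> - 1) *\<^sub>R M + N) *v rnms_iter \<theta> M N \<Omega> B c x0 k
          + B *v \<bar>rnms_iter \<theta> M N \<Omega> B c x0 k\<bar> + c)"

end

theory Submission
  imports Defs
begin

text \<open>
  Write \<open>P = \<theta>M + \<Omega>\<close> and \<open>K = \<Omega> + (\<theta> - 1)M + N\<close>.  As \<open>P - K = M - N = A\<close>, the solutions of the system
  are the fixed points of the iteration map \<open>x \<mapsto> P\<^sup>-\<^sup>1(Kx + B\<bar>x\<bar> + c)\<close>, and this map is a
  contraction because the componentwise absolute value is nonexpansive.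
\<close>

lemma norm_matrix_vector_mult_le_spectral_norm:
  "norm (M *v x) \<le> spectral_norm M * norm x"
  unfolding spectral_norm_def by (rule onorm) (rule matrix_vector_mul_bounded_linear)

lemma spectral_norm_nonneg: "0 \<le> spectral_norm M"
  unfolding spectral_norm_def by (rule onorm_pos_le) (rule matrix_vector_mul_bounded_linear)

text \<open>Entrywise this is the reverse triangle inequality, and the Euclidean norm is monotone in
  the absolute values of the entries.\<close>

lemma norm_abs_diff_abs_le:
  fixes x y :: "real ^ 'n"
  shows "norm (\<bar>x\<bar> - \<bar>y\<bar>) \<le> norm (x - y)"
  by (rule norm_le_componentwise_cart) (simp add: abs_vec_def)

text \<open>The shift \<open>d\<close> cancels in the difference, and passing from
  \<open>x - y\<close> to \<open>\<bar>x\<bar> - \<bar>y\<bar>\<close> costs no extra factor, so the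
  two spectral norms simply add up.\<close>

lemma dist_abs_affine_le:
  fixes G H :: "real ^ 'n ^ 'n"
  shows "dist (G *v x + H *v \<bar>x\<bar> + d) (G *v y + H *v \<bar>y\<bar> + d)
    \<le> (spectral_norm G + spectral_norm H) * dist x y"
proof -
  have "dist (G *v x + H *v \<bar>x\<bar> + d) (G *v y + H *v \<bar>y\<bar> + d)
      = norm (G *v (x - y) + H *v (\<bar>x\<bar> - \<bar>y\<bar>))"
    by (simp add: dist_norm matrix_vector_mult_diff_distrib algebra_simps)
  also have "\<dots> \<le> spectral_norm G * norm (x - y) + spectral_norm H * norm (\<bar>x\<bar> - \<bar>y\<bar>)"
    by (intro norm_triangle_mono norm_matrix_vector_mult_le_spectral_norm)
  also have "\<dots> \<le> spectral_norm G * norm (x - y) + spectral_norm H * norm (x - y)"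
    by (intro add_left_mono mult_left_mono norm_abs_diff_abs_le spectral_norm_nonneg)
  finally show ?thesis
    by (simp add: dist_norm distrib_right)
qed

lemma matrix_inv_mult_eq_iff:
  fixes P :: "real ^ 'n ^ 'n"
  assumes "invertible P"
  shows "matrix_inv P *v b = x \<longleftrightarrow> P *v x = b"
proof -
  \<comment> \<open>\<open>matrix_inv\<close> is a Hilbert choice; invertibility supplies the
    witness that makes the chosen matrix a two-sided inverse.\<close>
  have "P ** matrix_inv P = mat 1 \<and> matrix_inv P ** P = mat 1"
    using assms unfolding invertible_def matrix_inv_def by (rule someI_ex)
  then show ?thesis
    by (metis matrix_vector_mul_assoc matrix_vector_mul_lid)
qed

theorem corollary3p5:
  fixes A B M N \<Omega> :: "real ^ 'n ^ 'n" and c :: "real ^ 'n" and \<theta> :: real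
  assumes "A = M - N"
    and "\<theta> \<ge> 0"
    and "invertible (\<theta> *\<^sub>R M + \<Omega>)"
    and "spectral_norm (matrix_inv (\<theta> *\<^sub>R M + \<Omega>) ** (\<Omega> + (\<theta> - 1) *\<^sub>R M + N))
           + spectral_norm (matrix_inv (\<theta> *\<^sub>R M + \<Omega>) ** B) < 1"
  shows "\<exists>xs :: real ^ 'n.
           A *v xs - B *v \<bar>xs\<bar> - c = 0
           \<and> (\<forall>y. A *v y - B *v \<bar>y\<bar> - c = 0 \<longrightarrow> y = xs)
           \<and> (\<forall>x0. converges_linearly (rnms_iter \<theta> M N \<Omega> B c x0) xs)"
proof -
  define P where "P = \<theta> *\<^sub>R M + \<Omega>"
  define K where "K = \<Omega> + (\<theta> - 1) *\<^sub>R M + N"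
  define q where "q = spectral_norm (matrix_inv P ** K) + spectral_norm (matrix_inv P ** B)"
  define T where "T x = matrix_inv P *v (K *v x + B *v \<bar>x\<bar> + c)" for x
  have q: "0 \<le> q" "q < 1"
    using assms(4) by (simp_all add: q_def P_def K_def spectral_norm_nonneg)
  \<comment> \<open>Distributing \<open>matrix_inv P\<close> over the sum gives \<open>T\<close> the
    form \<open>G *v x + H *v \<bar>x\<bar> + d\<close>.\<close>
  have contraction: "dist (T x) (T y) \<le> q * dist x y" for x y
    using dist_abs_affine_le[of "matrix_inv P ** K" x "matrix_inv P ** B" "matrix_inv P *v c" y]
    by (simp add: T_def q_def matrix_vector_right_distrib matrix_vector_mul_assoc)
  have "P - K = A"
    by (simp add: P_def K_def assms(1) algebra_simps)
  then have A_mult: "A *v x = P *v x - K *v x" for x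
    by (metis matrix_vector_mult_diff_rdistrib)
  \<comment> \<open>Clearing the inverse turns \<open>T x = x\<close> into
    \<open>P *v x = K *v x + B *v \<bar>x\<bar> + c\<close>.\<close>
  have fixed_iff: "T x = x \<longleftrightarrow> A *v x - B *v \<bar>x\<bar> - c = 0" for x
    unfolding T_def matrix_inv_mult_eq_iff[OF assms(3)[folded P_def]] A_mult
    by (auto simp: algebra_simps)
  obtain xs where xs: "T xs = xs" "\<And>y. T y = y \<Longrightarrow> y = xs"
    using banach_fix_type[OF q, of T] contraction by blast
  have iter: "rnms_iter \<theta> M N \<Omega> B c x0 (Suc k) = T (rnms_iter \<theta> M N \<Omega> B c x0 k)" for x0 k
    by (simp add: T_def P_def K_def)
  \<comment> \<open>Since \<open>T xs = xs\<close>, the contraction estimate against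
    \<open>xs\<close> is the one-step error bound, so \<open>q\<close> is a rate valid for every
    \<open>x0\<close>.\<close>
  have "converges_linearly (rnms_iter \<theta> M N \<Omega> B c x0) xs" for x0
    unfolding converges_linearly_def iter
    using q contraction[of _ xs] xs(1) by (auto simp: dist_norm)
  then show ?thesis
    using xs fixed_iff by blast
qed

end
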